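(* Let $q$ be a power of a prime $p$, let $n\ge 1$, let $e=\nu_p(n)$ and $\tau=p^e$. Let $\alpha\in\mathbb{F}_{q^n}$ be a normal element of $\mathbb{F}_{q^n}$ over $\mathbb{F}_q$ with $\mathrm{Tr}_{\mathbb{F}_{q^n}:\mathbb{F}_q}(\alpha)=n/\tau$ (the integer $n/\tau$ viewed in $\mathbb{F}_p\subseteq\mathbb{F}_q$), and let $\beta=\phi_\alpha(g(x))$, with $g\in\mathbb{F}_q[x]$, also be normal. Then: 1. If $e>0$, then $\beta$ has normal $1$-depth $p$; moreover, $\beta-c$ is normal for all $c\in\mathbb{F}_q$. 2. If $e=0$, then, for every positive integer $b\le p$, $\beta$ has normal $1$-depth $b$ if and only if $g(1)\notin\{0,1,\ldots,b-1\}$ (integers viewed in $\mathbb{F}_p\subseteq \mathbb{F}_q$). In particular, for $c\in\mathbb{F}_q$, $\beta-c$ is normal if and only if $g(1)\neq c$.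
   Context: $\nu_p(n)$ is the largest integer $e$ such that $p^e$ divides $n$. An element $\alpha\in\mathbb{F}_{q^n}$ is normal (over $\mathbb{F}_q$) if $\alpha,\alpha^q,\ldots,\alpha^{q^{n-1}}$ are linearly independent over $\mathbb{F}_q$. For $f=\sum_i a_ix^i\in\mathbb{F}_q[x]$ put $f\circ\alpha=\sum_i a_i\alpha^{q^i}$, and for a normal $\alpha$ define $\phi_\alpha(f)=f\circ\alpha$; this induces an $\mathbb{F}_q$-linear isomorphism $\mathbb{F}_q[x]/(x^n-1)\to\mathbb{F}_{q^n}$, also denoted $\phi_\alpha$. For a positive integer $b\le p$ and $\gamma\in\mathbb{F}_{q^n}$, an element $\beta\in\mathbb{F}_{q^n}$ has normal $\gamma$-depth $b$ if $\beta,\beta-\gamma,\ldots,\beta-(b-1)\gamma$ are all normal elements of $\mathbb{F}_{q^n}$ over $\mathbb{F}_q$; normal $1$-depth is the case $\gamma=1$. *)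

theory Defs
  imports "HOL-Library.Cardinality" "HOL-Computational_Algebra.Computational_Algebra"
begin

locale field_embedding =
  fixes emb :: "'k::field \<Rightarrow> 'l::field"
  assumes emb_add: "emb (x + y) = emb x + emb y"
    and emb_mult: "emb (x * y) = emb x * emb y"
    and emb_one: "emb 1 = 1"

abbreviation emb_scale :: "('k::field \<Rightarrow> 'l::field) \<Rightarrow> 'k \<Rightarrow> 'l \<Rightarrow> 'l" where
  "emb_scale emb c x \<equiv> emb c * x"

lemma (in field_embedding) vector_space_emb_scale: "vector_space (emb_scale emb)"
  by unfold_locales (simp_all add: emb_add emb_mult emb_one algebra_simps)

(* In the definitions below emb embeds a field with q elements into one with q ^ n elements. *)

(* The library's independence is a property of sets; with inj_on it says that the family of
   conjugates is linearly independent. *)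
definition normal_element :: "('k::field \<Rightarrow> 'l::field) \<Rightarrow> nat \<Rightarrow> nat \<Rightarrow> 'l \<Rightarrow> bool" where
  "normal_element emb q n a \<longleftrightarrow>
     inj_on (\<lambda>i. a ^ (q ^ i)) {..<n} \<and>
     \<not> module.dependent (emb_scale emb) ((\<lambda>i. a ^ (q ^ i)) ` {..<n})"

(* The trace to the field with q elements, as the sum of the conjugates; its value lies in the
   image of emb. *)
definition field_trace :: "nat \<Rightarrow> nat \<Rightarrow> 'l::field \<Rightarrow> 'l" where
  "field_trace q n a = (\<Sum>i<n. a ^ (q ^ i))"

definition phi :: "('k::field \<Rightarrow> 'l::field) \<Rightarrow> nat \<Rightarrow> 'l \<Rightarrow> 'k poly \<Rightarrow> 'l" where
  "phi emb q a f = (\<Sum>i\<le>degree f. emb (coeff f i) * a ^ (q ^ i))"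

definition has_normal_depth ::
    "('k::field \<Rightarrow> 'l::field) \<Rightarrow> nat \<Rightarrow> nat \<Rightarrow> 'l \<Rightarrow> nat \<Rightarrow> 'l \<Rightarrow> bool" where
  "has_normal_depth emb q n c b x \<longleftrightarrow> (\<forall>j<b. normal_element emb q n (x - of_nat j * c))"

end

theory Submission
  imports Defs
begin

text \<open>
  Write \<open>M = x\<^sup>n - 1\<close>. The Frobenius map \<open>y \<mapsto> y\<^sup>q\<close> is linear over the small field and satisfies
  \<open>y ^ (q ^ n) = y\<close>. Letting \<open>x\<close> act by it makes the large field a module over the polynomials, in
  which \<open>phi emb q a f\<close> is the product of the scalar \<open>f\<close> with \<open>a\<close>, and \<open>M\<close> annihilates everything. An
  element is normal exactly when its annihilator is no larger than \<open>(M)\<close>. Hence, for a normal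
  \<open>\<alpha>\<close>, the element \<open>phi emb q \<alpha> g\<close> is normal if and only if multiplication by \<open>g\<close> is injective
  modulo \<open>M\<close> (lemma \<open>normal_phi_iff\<close>).

  Now \<open>M = (x - 1) h\<close> with \<open>h = 1 + x + \<dots> + x\<^sup>n\<^sup>-\<^sup>1\<close>, and \<open>h\<close> acts as the trace. With
  \<open>m = n / \<tau>\<close>, which is nonzero in the small field, the hypothesis on the trace says that
  \<open>h\<close> sends \<open>\<alpha>\<close> to \<open>m\<close>, so that \<open>\<beta> - c\<close> is the image of \<open>g - (c/m) h\<close>. Among the
  roots of \<open>M\<close>, subtracting a multiple \<open>t h\<close> can change the value of a polynomial only at \<open>1\<close>, where
  \<open>h(1) = n\<close>. This is the reason for lemma \<open>xn1_dvd_cancel_shift_iff\<close>: if \<open>g\<close> is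
  cancellable modulo \<open>M\<close>, then \<open>g - t h\<close> is cancellable if and only if \<open>g(1) \<noteq> t n\<close>. For \<open>t = c/m\<close> the condition reads \<open>g(1) \<noteq> c \<tau>\<close>. It is
  \<open>g(1) \<noteq> c\<close> if \<open>e = 0\<close>. If \<open>e > 0\<close>, it is \<open>g(1) \<noteq> 0\<close>, which is the case \<open>c = 0\<close> and
  therefore a consequence of the normality of \<open>\<beta>\<close>. The statements on depth are the cases
  \<open>c = 0, 1, \<dots>, b - 1\<close>.

  Working with cancellation instead of coprimality avoids gcds and any further factorisation of \<open>M\<close>.
\<close>

section \<open>Finite fields and linearly independent families\<close>

lemma finite_field_of_nat_card: "of_nat CARD('a) = (0 :: 'a::{field,finite})"
proof -
  \<comment> \<open>Translation by \<open>1\<close> permutes the field and so preserves the sum of all its elements.\<close>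
  have "(\<Sum>x\<in>UNIV. x + 1) = (\<Sum>x\<in>UNIV. x :: 'a)"
    by (rule sum.reindex_bij_witness[of _ "\<lambda>x. x - 1" "\<lambda>x. x + 1"]) auto
  then show ?thesis
    by (simp add: sum.distrib)
qed

lemma finite_field_power_card: "x ^ CARD('a) = (x :: 'a::{field,finite})"
proof (cases "x = 0")
  case False
  \<comment> \<open>Multiplication by \<open>x\<close> permutes the nonzero elements and so preserves their product.\<close>
  have "(\<Prod>y\<in>-{0}. x * y) = (\<Prod>y\<in>-{0}. y)"
    by (rule prod.reindex_bij_witness[of _ "\<lambda>y. y / x" "\<lambda>y. x * y"]) (use False in auto)
  then have "x ^ (CARD('a) - 1) = 1"
    by (simp add: prod.distrib Compl_eq_Diff_UNIV)
  then show ?thesis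
    using zero_less_card_finite[where 'a = 'a] by (simp add: power_eq_if)
qed (simp add: zero_less_card_finite)

lemma finite_field_CHAR_eq:
  assumes "prime p" and "CARD('a::{field,finite}) = p ^ k"
  shows "CHAR('a) = p"
proof -
  have "of_nat (p ^ k) = (0 :: 'a)"
    using finite_field_of_nat_card[where 'a = 'a] assms(2) by simp
  then have "of_nat p = (0 :: 'a)"
    by (simp add: power_eq_0_iff)
  then have "CHAR('a) dvd p"
    by (simp add: of_nat_eq_0_iff_char_dvd)
  then show ?thesis
    using assms(1) by (auto simp: prime_nat_iff)
qed

lemma (in module) independent_family_iff:
  assumes "finite I"
  shows "inj_on v I \<and> \<not> dependent (v ` I) \<longleftrightarrow>
    (\<forall>c. (\<Sum>i\<in>I. c i *s v i) = 0 \<longrightarrow> (\<forall>i\<in>I. c i = 0))" (is "?L \<longleftrightarrow> ?R")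
proof
  assume L: ?L
  show ?R
  proof (intro allI impI ballI)
    fix c i assume c: "(\<Sum>i\<in>I. c i *s v i) = 0" and i: "i \<in> I"
    have "(\<Sum>w\<in>v ` I. c (the_inv_into I v w) *s w) = (\<Sum>i\<in>I. c i *s v i)"
      using L by (subst sum.reindex) (auto simp: the_inv_into_f_f intro!: sum.cong)
    then have "c (the_inv_into I v (v i)) = 0"
      using L c i assms by (intro independentD[of "v ` I" "v ` I"]) auto
    then show "c i = 0"
      using L i by (simp add: the_inv_into_f_f)
  qed
next
  assume R: ?R
  have inj: "inj_on v I"
  proof (rule inj_onI, rule ccontr)
    fix i j assume ij: "i \<in> I" "j \<in> I" "v i = v j" "i \<noteq> j"
    define c where "c = (\<lambda>k. if k = i then 1 else if k = j then - 1 else 0 :: 'a)"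
    have "(\<Sum>k\<in>I. c k *s v k) = (\<Sum>k\<in>{i, j}. c k *s v k)"
      using ij assms by (intro sum.mono_neutral_right) (auto simp: c_def)
    also have "\<dots> = 0"
      using ij by (simp add: c_def)
    finally have "c i = 0"
      using R ij by blast
    then show False
      by (simp add: c_def)
  qed
  moreover have "\<not> dependent (v ` I)"
  proof
    assume "dependent (v ` I)"
    then obtain u where u: "\<exists>w\<in>v ` I. u w \<noteq> 0" "(\<Sum>w\<in>v ` I. u w *s w) = 0"
      using assms by (auto simp: dependent_finite)
    then have "(\<Sum>i\<in>I. u (v i) *s v i) = 0"
      using inj by (simp add: sum.reindex)
    with R have "\<forall>i\<in>I. u (v i) = 0"
      by (auto dest: spec[of _ "\<lambda>i. u (v i)"])
    with u(1) show False
      by auto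
  qed
  ultimately show ?L
    by blast
qed

section \<open>Cancellation modulo a polynomial of the form \<open>x\<^sup>n - 1\<close>\<close>

abbreviation xn1 :: "nat \<Rightarrow> 'a::comm_ring_1 poly" where
  "xn1 n \<equiv> monom 1 n - 1"

definition all_ones :: "nat \<Rightarrow> 'a::comm_ring_1 poly" where
  "all_ones n = (\<Sum>i<n. monom 1 i)"

lemma xn1_eq_mult_all_ones: "xn1 n = [:-1, 1:] * (all_ones n :: 'a::comm_ring_1 poly)"
proof -
  have "[:-1, 1:] = monom 1 1 - (1 :: 'a poly)"
    by (simp add: monom_altdef one_pCons)
  moreover have "monom 1 1 ^ k = (monom 1 k :: 'a poly)" for k
    by (simp add: monom_power)
  ultimately show ?thesis
    using power_diff_1_eq[of "monom 1 1 :: 'a poly" n] by (simp add: all_ones_def)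
qed

lemma coeff_all_ones: "coeff (all_ones n :: 'a::comm_ring_1 poly) i = (if i < n then 1 else 0)"
  by (simp add: all_ones_def coeff_sum)

lemma poly_all_ones_1: "poly (all_ones n) 1 = (of_nat n :: 'a::comm_ring_1)"
  by (simp add: all_ones_def poly_sum poly_monom)

lemma degree_xn1: "n \<ge> 1 \<Longrightarrow> degree (xn1 n :: 'a::comm_ring_1 poly) = n"
  using degree_add_eq_left[of "- 1" "monom 1 n :: 'a poly"] by (simp add: degree_monom_eq)

text \<open>
  Write \<open>M = x\<^sup>n - 1 = (x - 1) h\<close>. Multiplying a multiple \<open>f (g - t h)\<close> of \<open>M\<close> by \<open>x - 1\<close> removes the
  term with \<open>h\<close> modulo \<open>M\<close>, so that cancelling \<open>g\<close> leaves \<open>f = h k\<close>. The remaining factor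
  \<open>x - 1\<close> must divide \<open>k (g - t h)\<close>, and divisibility by \<open>x - 1\<close> is evaluation at \<open>1\<close>. Conversely, if \<open>g - t h\<close> vanishes at \<open>1\<close>, then
  \<open>h\<close> is annihilated by it modulo \<open>M\<close> without being a multiple of \<open>M\<close>.
\<close>

lemma xn1_dvd_cancel_shift_iff:
  fixes g :: "'a::field poly"
  assumes "n \<ge> 1" and cancel: "\<And>f. xn1 n dvd f * g \<Longrightarrow> xn1 n dvd f"
  shows "(\<forall>f. xn1 n dvd f * (g - smult t (all_ones n)) \<longrightarrow> xn1 n dvd f) \<longleftrightarrow>
    poly g 1 \<noteq> t * of_nat n" (is "?L \<longleftrightarrow> ?R")
proof -
  define X h where "X = [:-1, 1 :: 'a:]" and "h = (all_ones n :: 'a poly)"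
  let ?g = "g - smult t h"
  have M: "xn1 n = X * h"
    unfolding X_def h_def by (rule xn1_eq_mult_all_ones)
  have X_dvd: "X dvd f \<longleftrightarrow> poly f 1 = 0" for f
    by (simp add: X_def poly_eq_0_iff_dvd)
  have "coeff h 0 = 1"
    using assms(1) by (simp add: h_def coeff_all_ones)
  then have h0: "h \<noteq> 0"
    by auto
  have X0: "X \<noteq> 0"
    by (simp add: X_def)
  have g1: "poly ?g 1 = 0 \<longleftrightarrow> poly g 1 = t * of_nat n"
    by (simp add: h_def poly_all_ones_1)
  have "?L \<longleftrightarrow> (\<forall>f. X * h dvd f * ?g \<longrightarrow> X * h dvd f)"
    by (simp add: M h_def)
  also have "\<dots> \<longleftrightarrow> poly ?g 1 \<noteq> 0"
  proof
    assume L: "\<forall>f. X * h dvd f * ?g \<longrightarrow> X * h dvd f"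
    show "poly ?g 1 \<noteq> 0"
    proof
      assume "poly ?g 1 = 0"
      then have "X * h dvd h * ?g"
        by (subst mult.commute[of X]) (intro mult_dvd_mono dvd_refl, simp add: X_dvd)
      with L have "X * h dvd h"
        by blast
      with h0 have "X dvd 1"
        using dvd_mult_cancel_right[of X h 1] by simp
      then show False
        by (simp add: X_dvd)
    qed
  next
    assume R: "poly ?g 1 \<noteq> 0"
    show "\<forall>f. X * h dvd f * ?g \<longrightarrow> X * h dvd f"
    proof (intro allI impI)
      fix f assume f: "X * h dvd f * ?g"
      have "(X * f) * g = X * (f * ?g) + smult t f * (X * h)"
        by (simp add: algebra_simps)
      with f have "X * h dvd (X * f) * g"
        by (simp only: dvd_add dvd_mult dvd_triv_right)
      then have "X * h dvd X * f"
        by (rule cancel[unfolded M])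
      with X0 obtain k where k: "f = h * k"
        by (auto simp: dvd_def)
      from f have "h * X dvd h * (k * ?g)"
        by (simp add: k mult_ac)
      with h0 have "X dvd k * ?g"
        by simp
      with R have "X dvd k"
        by (simp add: X_dvd)
      then show "X * h dvd f"
        by (simp add: k mult.commute[of X])
    qed
  qed
  finally show ?thesis
    using g1 by blast
qed

section \<open>The large field as a module over the polynomials\<close>

locale finite_field_extension = field_embedding emb
  for emb :: "'k::{field,finite} \<Rightarrow> 'l::{field,finite}" +
  fixes p r q n :: nat
  assumes prime_p: "prime p" and q_eq: "q = p ^ r" and n_pos: "n \<ge> 1"
    and card_k: "CARD('k) = q" and card_l: "CARD('l) = q ^ n"
begin

sublocale vector_space "emb_scale emb"
  by (rule vector_space_emb_scale)

lemma emb_zero [simp]: "emb 0 = 0"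
  using emb_add[of 0 0] by (metis add_0 add_right_imp_eq)

lemma emb_of_nat: "emb (of_nat k) = of_nat k"
  by (induction k) (simp_all add: emb_add emb_one)

lemma emb_power_q: "emb c ^ q = emb c"
proof -
  have "emb (c ^ k) = emb c ^ k" for k
    by (induction k) (simp_all add: emb_mult emb_one)
  then show ?thesis
    using finite_field_power_card[of c] card_k by metis
qed

lemma frobenius_add: "(x + y :: 'l) ^ q = x ^ q + y ^ q"
proof -
  have "CHAR('l) = p"
    using prime_p card_l q_eq by (intro finite_field_CHAR_eq[of p "r * n"]) (simp_all add: power_mult)
  then show ?thesis
    using prime_p q_eq by (intro freshmans_dream') simp_all
qed

lemma q_pos: "q > 0"
  using prime_p q_eq by (simp add: prime_gt_0_nat)

lemma frobenius_sum: "(\<Sum>i\<in>A. f i :: 'l) ^ q = (\<Sum>i\<in>A. f i ^ q)"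
  using q_pos by (induction A rule: infinite_finite_induct) (simp_all add: frobenius_add)

lemma phi_eq_sum:
  assumes "degree f \<le> N"
  shows "phi emb q a f = (\<Sum>i\<le>N. emb (coeff f i) * a ^ (q ^ i))"
  unfolding phi_def using assms
  by (intro sum.mono_neutral_left) (auto simp: coeff_eq_0)

lemma phi_zero [simp]: "phi emb q a 0 = 0"
  by (simp add: phi_def)

lemma phi_add: "phi emb q a (f + g) = phi emb q a f + phi emb q a g"
proof -
  define N where "N = max (degree f) (degree g)"
  have "degree f \<le> N" "degree g \<le> N" "degree (f + g) \<le> N"
    by (auto simp: N_def intro: degree_add_le)
  then show ?thesis
    by (simp add: phi_eq_sum[of _ N] emb_add sum.distrib algebra_simps)
qed

lemma phi_smult: "phi emb q a (smult c f) = emb c * phi emb q a f"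
proof -
  have "phi emb q a (smult c f) = (\<Sum>i\<le>degree f. emb (coeff (smult c f) i) * a ^ (q ^ i))"
    by (rule phi_eq_sum) (rule degree_smult_le)
  then show ?thesis
    by (simp add: phi_def sum_distrib_left)
qed

lemma phi_diff: "phi emb q a (f - g) = phi emb q a f - phi emb q a g"
  using phi_add[of a "f - g" g] by simp

lemma phi_sum: "phi emb q a (\<Sum>i\<in>A. f i) = (\<Sum>i\<in>A. phi emb q a (f i))"
  by (induction A rule: infinite_finite_induct) (simp_all add: phi_add)

lemma phi_monom: "phi emb q a (monom c i) = emb c * a ^ (q ^ i)"
proof -
  have "phi emb q a (monom c i) = (\<Sum>j\<le>i. emb (coeff (monom c i) j) * a ^ (q ^ j))"
    by (rule phi_eq_sum) (rule degree_monom_le)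
  also have "\<dots> = (\<Sum>j\<le>i. if j = i then emb c * a ^ (q ^ j) else 0)"
    by (intro sum.cong) auto
  finally show ?thesis
    by simp
qed

lemma phi_pCons: "phi emb q a (pCons c f) = emb c * a + phi emb q a f ^ q"
proof -
  have "phi emb q a (pCons c f) =
      (\<Sum>i\<le>Suc (degree f). emb (coeff (pCons c f) i) * a ^ (q ^ i))"
    by (rule phi_eq_sum) (rule degree_pCons_le)
  also have "\<dots> = emb c * a + (\<Sum>i\<le>degree f. emb (coeff f i) * a ^ (q ^ Suc i))"
    by (subst sum.atMost_Suc_shift) simp
  also have "(\<Sum>i\<le>degree f. emb (coeff f i) * a ^ (q ^ Suc i)) = phi emb q a f ^ q"
    by (simp add: phi_def frobenius_sum power_mult_distrib emb_power_q mult.commute[of q]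
        flip: power_mult)
  finally show ?thesis .
qed

text \<open>
  This law makes \<open>phi\<close> a module action. In \<open>phi_pCons\<close>, on which it rests, raising to the power \<open>q\<close>
  shifts the conjugates but leaves the coefficients alone, because \<open>emb c ^ q = emb c\<close>.
\<close>

lemma phi_mult: "phi emb q a (f * g) = phi emb q (phi emb q a g) f"
  by (induction f) (simp_all add: phi_pCons phi_add phi_smult)

lemma phi_xn1: "phi emb q a (xn1 n) = 0"
  using phi_monom[of a 1 n] phi_monom[of a 1 0] finite_field_power_card[of a] card_l
  by (simp add: phi_diff emb_one)

lemma phi_all_ones: "phi emb q a (all_ones n) = field_trace q n a"
  by (simp add: all_ones_def field_trace_def phi_sum phi_monom emb_one)

lemma phi_mod_xn1: "phi emb q a (f mod xn1 n) = phi emb q a f"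
proof -
  have "phi emb q a f = phi emb q a (f div xn1 n * xn1 n + f mod xn1 n)"
    by (simp only: div_mult_mod_eq)
  also have "\<dots> = phi emb q a (f mod xn1 n)"
    by (simp only: phi_add phi_mult phi_xn1) (use q_pos in \<open>simp add: phi_def power_0_left\<close>)
  finally show ?thesis ..
qed

section \<open>Normal elements\<close>

text \<open>
  Linear independence of the conjugates says that no nonzero polynomial of degree less than \<open>n\<close>
  annihilates \<open>a\<close>; such polynomials represent all classes modulo \<open>x\<^sup>n - 1\<close>.
\<close>

lemma normal_iff_annihilator:
  "normal_element emb q n a \<longleftrightarrow> (\<forall>f. phi emb q a f = 0 \<longrightarrow> xn1 n dvd f)"
proof -
  have "normal_element emb q n a \<longleftrightarrow>
      (\<forall>c. (\<Sum>i<n. emb (c i) * a ^ (q ^ i)) = 0 \<longrightarrow> (\<forall>i<n. c i = 0))"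
    using independent_family_iff[of "{..<n}" "\<lambda>i. a ^ (q ^ i)"]
    by (simp add: normal_element_def Ball_def)
  also have "\<dots> \<longleftrightarrow> (\<forall>f. phi emb q a f = 0 \<longrightarrow> xn1 n dvd f)" (is "?L \<longleftrightarrow> ?R")
  proof
    assume L: ?L
    show ?R
    proof (intro allI impI)
      fix f :: "'k poly" assume f: "phi emb q a f = 0"
      define s where "s = f mod xn1 n"
      have M0: "(xn1 n :: 'k poly) \<noteq> 0"
        using degree_xn1[OF n_pos, where 'a = 'k] n_pos by (metis degree_0 not_one_le_zero)
      have s: "degree s < n"
        using degree_mod_less'[of "xn1 n" f] M0 n_pos degree_xn1[OF n_pos, where 'a = 'k]
        by (cases "s = 0") (auto simp: s_def)
      then have "phi emb q a s = (\<Sum>i\<le>n - 1. emb (coeff s i) * a ^ (q ^ i))"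
        by (intro phi_eq_sum) simp
      also have "{..n - 1} = {..<n}"
        using n_pos by auto
      finally have "(\<Sum>i<n. emb (coeff s i) * a ^ (q ^ i)) = 0"
        using f by (simp add: s_def phi_mod_xn1)
      with L have "\<forall>i<n. coeff s i = 0"
        by (auto dest: spec[of _ "coeff s"])
      then have "s = 0"
        using s by (metis leading_coeff_0_iff)
      then show "xn1 n dvd f"
        by (simp add: s_def dvd_eq_mod_eq_0)
    qed
  next
    assume R: ?R
    show ?L
    proof (intro allI impI)
      fix c i assume c: "(\<Sum>i<n. emb (c i) * a ^ (q ^ i)) = 0" and i: "i < n"
      define f where "f = (\<Sum>i<n. monom (c i) i)"
      have "phi emb q a f = 0"
        using c by (simp add: f_def phi_sum phi_monom)
      with R have dvd: "xn1 n dvd f"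
        by blast
      have "degree f \<le> n - 1"
        unfolding f_def by (intro degree_sum_le) (auto intro: order_trans[OF degree_monom_le])
      then have "degree f < degree (xn1 n :: 'k poly)"
        using n_pos by (simp add: degree_xn1)
      with dvd have "f = 0"
        by (metis dvd_imp_degree_le not_le)
      moreover have "coeff f i = c i"
        using i by (simp add: f_def coeff_sum)
      ultimately show "c i = 0"
        by simp
    qed
  qed
  finally show ?thesis .
qed

lemma normal_phi_iff:
  assumes "normal_element emb q n a"
  shows "normal_element emb q n (phi emb q a g) \<longleftrightarrow> (\<forall>f. xn1 n dvd f * g \<longrightarrow> xn1 n dvd f)"
proof -
  have "phi emb q a f = 0 \<longleftrightarrow> xn1 n dvd f" for f
  proof
    assume "xn1 n dvd f"
    then have "f mod xn1 n = 0"
      by simp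
    then show "phi emb q a f = 0"
      using phi_mod_xn1[of a f] by simp
  qed (use assms normal_iff_annihilator in blast)
  then show ?thesis
    unfolding normal_iff_annihilator[of "phi emb q a g"] by (simp flip: phi_mult)
qed

text \<open>
  The trace of \<open>a\<close> enters as the image of \<open>all_ones n\<close>: it turns the constant \<open>c\<close> into the
  multiple \<open>c / m\<close> of that polynomial.
\<close>

lemma normal_phi_minus_const_iff:
  assumes "normal_element emb q n a" and "normal_element emb q n (phi emb q a g)"
    and trace: "field_trace q n a = emb m" and "m \<noteq> 0"
  shows "normal_element emb q n (phi emb q a g - emb c) \<longleftrightarrow> poly g 1 \<noteq> c / m * of_nat n"
proof -
  have "phi emb q a g - emb c = phi emb q a (g - smult (c / m) (all_ones n))"
    using \<open>m \<noteq> 0\<close> by (simp add: phi_diff phi_smult phi_all_ones trace flip: emb_mult)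
  then show ?thesis
    using assms(1,2) n_pos xn1_dvd_cancel_shift_iff[of n g "c / m"] by (metis normal_phi_iff)
qed

end

theorem theorem1:
  fixes emb :: "'k::{field,finite} \<Rightarrow> 'l::{field,finite}"
    and p q n e r \<tau> :: nat and \<alpha> \<beta> :: 'l and g :: "'k poly"
  assumes "prime p" and "r \<ge> 1" and "q = p ^ r" and "n \<ge> 1"
    and "CARD('k) = q" and "CARD('l) = q ^ n" and "field_embedding emb"
    and "e = multiplicity p n" and "\<tau> = p ^ e"
    and "normal_element emb q n \<alpha>"
    and "field_trace q n \<alpha> = emb (of_nat (n div \<tau>))"
    and "\<beta> = phi emb q \<alpha> g"
    and "normal_element emb q n \<beta>"
  shows "(e > 0 \<longrightarrow>
            has_normal_depth emb q n 1 p \<beta> \<and>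
            (\<forall>c. normal_element emb q n (\<beta> - emb c))) \<and>
         (e = 0 \<longrightarrow>
            (\<forall>b. 1 \<le> b \<and> b \<le> p \<longrightarrow>
               (has_normal_depth emb q n 1 b \<beta> \<longleftrightarrow> poly g 1 \<notin> of_nat ` {0..<b})) \<and>
            (\<forall>c. normal_element emb q n (\<beta> - emb c) \<longleftrightarrow> poly g 1 \<noteq> c))"
proof -
  interpret finite_field_extension emb p r q n
    using assms by (simp add: finite_field_extension_def finite_field_extension_axioms_def)
  have char: "CHAR('k) = p"
    using assms by (intro finite_field_CHAR_eq[of p r]) simp_all
  define m where "m = n div \<tau>"
  have n_eq: "n = m * \<tau>"
    using assms by (simp add: m_def multiplicity_dvd)
  have "\<not> p dvd m"
    unfolding m_def using assms
    by (metis multiplicity_decompose not_one_le_zero not_prime_unit)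
  then have m0: "of_nat m \<noteq> (0 :: 'k)"
    by (simp add: of_nat_eq_0_iff_char_dvd char)
  have normal: "normal_element emb q n (\<beta> - emb c) \<longleftrightarrow> poly g 1 \<noteq> c * of_nat \<tau>" for c
  proof -
    have "normal_element emb q n (\<beta> - emb c) \<longleftrightarrow> poly g 1 \<noteq> c / of_nat m * of_nat n"
      unfolding assms(12)
      by (rule normal_phi_minus_const_iff) (use assms m0 in \<open>auto simp: m_def\<close>)
    then show ?thesis
      using m0 by (simp add: n_eq)
  qed
  have depth: "has_normal_depth emb q n 1 b \<beta> \<longleftrightarrow> (\<forall>j<b. poly g 1 \<noteq> of_nat j * of_nat \<tau>)" for b
    using normal[of "of_nat _"] by (simp add: has_normal_depth_def emb_of_nat)
  show ?thesis
  proof (intro conjI impI)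
    assume "e > 0"
    then have "of_nat \<tau> = (0 :: 'k)"
      using assms by (simp add: of_nat_eq_0_iff_char_dvd char)
    moreover from this have "poly g 1 \<noteq> 0"
      using normal[of 0] assms by simp
    ultimately show "has_normal_depth emb q n 1 p \<beta>" "\<forall>c. normal_element emb q n (\<beta> - emb c)"
      by (simp_all add: depth normal)
  next
    assume "e = 0"
    then have "\<tau> = 1"
      using assms by simp
    then show "\<forall>b. 1 \<le> b \<and> b \<le> p \<longrightarrow>
        (has_normal_depth emb q n 1 b \<beta> \<longleftrightarrow> poly g 1 \<notin> of_nat ` {0..<b})"
      and "\<forall>c. normal_element emb q n (\<beta> - emb c) \<longleftrightarrow> poly g 1 \<noteq> c"
      by (auto simp: depth normal)
  qed
qed

end
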